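(* Let $m,n$ be positive integers, let $\lambda_{ij}>0$ for $1\le i\le m$ and $1\le j\le n$, let $\nu_i=\sum_{j=1}^n\lambda_{ij}$ for $1\le i\le m$ and $\tau_j=\sum_{i=1}^m\lambda_{ij}$ for $1\le j\le n$, and let $\rho,\theta\in\mathbb{R}$. If $\rho\le2$ and $\theta\ge0$, then the function $$P(t)=\sum_{i=1}^m\nu_i^{\theta+2}\psi'(1+\nu_it)+\sum_{j=1}^n\tau_j^{\theta+2}\psi'(1+\tau_jt)-\rho\sum_{i=1}^m\sum_{j=1}^n\lambda_{ij}^{\theta+2}\psi'(1+\lambda_{ij}t)$$ is completely monotonic on $(0,\infty)$.
   Context: $\psi(x)=[\ln\Gamma(x)]'=\Gamma'(x)/\Gamma(x)$ is the digamma function, where $\Gamma$ is the classical gamma function, and $\psi'$ is the trigamma function. A real-valued function $F$ on an interval $I$ is completely monotonic on $I$ if it is infinitely differentiable and $(-1)^kF^{(k)}(x)\ge0$ for all integers $k\ge0$ and all $x\in I$. *)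

theory Defs
  imports "HOL-Analysis.Analysis"
begin

text \<open>
  The function \<open>D k\<close> plays the role of the \<open>k\<close>-th derivative of \<open>F\<close> on \<open>I\<close>; an end point
  belonging to \<open>I\<close> gets one-sided derivatives.  The interval is required to have nonempty
  interior, so that derivatives within \<open>I\<close> are unique and \<open>D\<close> is determined on \<open>I\<close> by \<open>F\<close>.
\<close>
definition completely_monotonic_on :: "real set \<Rightarrow> (real \<Rightarrow> real) \<Rightarrow> bool" where
  "completely_monotonic_on I F \<longleftrightarrow>
     is_interval I \<and> interior I \<noteq> {} \<and>
     (\<exists>D :: nat \<Rightarrow> real \<Rightarrow> real.
        (\<forall>x\<in>I. D 0 x = F x) \<and>
        (\<forall>k. \<forall>x\<in>I. (D k has_real_derivative D (Suc k) x) (at x within I)) \<and>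
        (\<forall>k. \<forall>x\<in>I. 0 \<le> (-1) ^ k * D k x))"

end

theory Submission
  imports Defs
begin

text \<open>
  The signed \<open>k\<close>-th derivative of \<open>x\<^sup>\<theta>\<^sup>+\<^sup>2 \<psi>'(1 + x t)\<close> in \<open>t\<close> is superadditive in \<open>x\<close>,
  because its quotient by \<open>x\<close> is a multiple of \<open>x\<^sup>\<theta> y\<^sup>n \<bar>\<psi>\<^sup>(\<^sup>n\<^sup>)(1 + y)\<bar>\<close> with
  \<open>y = x t\<close> and \<open>n = k + 1\<close>, and \<open>y\<^sup>n \<bar>\<psi>\<^sup>(\<^sup>n\<^sup>)(1 + y)\<bar>\<close> is increasing in \<open>y\<close>.
  Superadditivity along the rows and along the columns of the matrix shows that each of the first two
  sums dominates the double sum, which is nonnegative.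
\<close>

lemma neg_one_power_mult_Polygamma_sums:
  fixes x :: real
  assumes "0 \<le> x" "0 < n"
  shows "(\<lambda>k. fact n / (x + real k + 1) ^ Suc n) sums ((-1) ^ Suc n * Polygamma n (1 + x))"
proof -
  have "(\<lambda>k. inverse ((1 + x + of_nat k) ^ Suc n)) sums ((-1) ^ Suc n * Polygamma n (1 + x) / fact n)"
    by (rule Polygamma_LIMSEQ) (use assms in auto)
  from sums_mult[OF this, of "fact n"] show ?thesis
    by (simp add: field_simps)
qed

lemma neg_one_power_mult_Polygamma_nonneg:
  fixes x :: real
  assumes "0 \<le> x" "0 < n"
  shows "0 \<le> (-1) ^ Suc n * Polygamma n (1 + x)"
  using assms by (intro sums_le[OF _ sums_zero neg_one_power_mult_Polygamma_sums]) auto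

text \<open>Bernoulli's inequality for \<open>y / (y + 1) = 1 - 1 / (y + 1)\<close>, divided by
  \<open>y ^ N\<close>. It replaces the mean value bound for \<open>y ^ (-N)\<close> on a step of
  length 1.\<close>

lemma inverse_power_diff_le:
  fixes y :: real
  assumes "0 < y"
  shows "1 / y ^ N - 1 / (y + 1) ^ N \<le> real N / y ^ Suc N"
proof -
  have "1 - real N / y \<le> 1 + real N * (- 1 / (y + 1))"
    using assms by (simp add: field_simps)
  also have "\<dots> \<le> (1 + (- 1 / (y + 1))) ^ N"
    using assms by (intro Bernoulli_inequality) (simp add: field_simps)
  also have "1 + (- 1 / (y + 1)) = y / (y + 1)"
    using assms by (simp add: field_simps)
  finally have "1 - real N / y \<le> y ^ N / (y + 1) ^ N"
    by (simp add: power_divide)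
  from divide_right_mono[OF this, of "y ^ N"] show ?thesis
    using assms by (simp add: diff_divide_distrib algebra_simps)
qed

text \<open>
  Compares the two series termwise up to the telescoping sequence \<open>k / (x + k + 1)\<^sup>n\<^sup>+\<^sup>1\<close>,
  which vanishes at \<open>k = 0\<close> and at infinity.
\<close>
lemma mult_Polygamma_Suc_le:
  fixes x :: real
  assumes "0 \<le> x" "0 < n"
  shows "x * ((-1) ^ Suc (Suc n) * Polygamma (Suc n) (1 + x))
           \<le> real n * ((-1) ^ Suc n * Polygamma n (1 + x))"
proof -
  define C where "C k = real k / (x + real k + 1) ^ Suc n" for k
  have C_lim: "C \<longlonglongrightarrow> 0"
  proof (rule tendsto_sandwich[OF _ _ tendsto_const LIMSEQ_inverse_real_of_nat])
    show "\<forall>\<^sub>F k in sequentially. 0 \<le> C k"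
      using assms by (simp add: C_def)
    have "C k \<le> inverse (real (Suc k))" for k
    proof -
      \<comment> \<open>The exponent \<open>Suc n\<close> is at least 2 because
        \<open>0 < n\<close>, so the numerator \<open>k\<close> leaves decay of order
        \<open>1 / k\<close>.\<close>
      have "real (Suc k) * real k \<le> (x + real k + 1) ^ 2"
        unfolding power2_eq_square using assms by (intro mult_mono) auto
      also have "\<dots> \<le> (x + real k + 1) ^ Suc n"
        using assms by (intro power_increasing) auto
      finally show ?thesis
        using assms by (simp add: C_def field_simps del: power_Suc)
    qed
    then show "\<forall>\<^sub>F k in sequentially. C k \<le> inverse (real (Suc k))"
      by simp
  qed
  have step: "C k - C (Suc k) + x * (real (Suc n) / (x + real k + 1) ^ Suc (Suc n))
                \<le> real n * (1 / (x + real k + 1) ^ Suc n)" for k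
  proof -
    define y where "y = x + real k + 1"
    define a where "a = 1 / y ^ Suc n"
    define a' where "a' = 1 / (y + 1) ^ Suc n"
    define b where "b = real (Suc n) / y ^ Suc (Suc n)"
    have y: "0 < y" using assms by (simp add: y_def)
    have yb: "y * b = real (Suc n) * a"
      using y by (simp add: a_def b_def)
    \<comment> \<open>Here \<open>C k - C (Suc k) = (k + 1) * (a - a') - a\<close>, while
      \<open>x = y - (k + 1)\<close> gives \<open>x * b = (n + 1) * a - (k + 1) * b\<close>.
      Bounding \<open>a - a'\<close> by \<open>b\<close> cancels the multiples of \<open>b\<close>
      and leaves \<open>n * a\<close>.\<close>
    have "real (Suc k) * (a - a') \<le> real (Suc k) * b"
      unfolding a_def a'_def b_def by (intro mult_left_mono inverse_power_diff_le[OF y]) auto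
    moreover have "C k = real k * a" "C (Suc k) = real (Suc k) * a'"
      by (simp_all add: C_def a_def a'_def y_def add_ac)
    moreover have "x * b = y * b - real (Suc k) * b"
      by (simp add: y_def algebra_simps)
    ultimately have "C k - C (Suc k) + x * b \<le> real n * a"
      unfolding yb by (simp add: algebra_simps)
    then show ?thesis by (simp only: a_def b_def y_def)
  qed
  \<comment> \<open>The first summand is the value of the telescoping series; it vanishes since
    \<open>C 0 = 0\<close>.\<close>
  have "fact n * (C 0 - 0) + x * ((-1) ^ Suc (Suc n) * Polygamma (Suc n) (1 + x))
      \<le> real n * ((-1) ^ Suc n * Polygamma n (1 + x))"
  proof (rule sums_le)
    show "fact n * (C k - C (Suc k)) + x * (fact (Suc n) / (x + real k + 1) ^ Suc (Suc n))
        \<le> real n * (fact n / (x + real k + 1) ^ Suc n)" for k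
      using mult_left_mono[OF step[of k], of "fact n"] by (simp add: algebra_simps)
    show "(\<lambda>k. fact n * (C k - C (Suc k)) + x * (fact (Suc n) / (x + real k + 1) ^ Suc (Suc n))) sums
        (fact n * (C 0 - 0) + x * ((-1) ^ Suc (Suc n) * Polygamma (Suc n) (1 + x)))"
      using assms
      by (intro sums_add sums_mult telescope_sums' neg_one_power_mult_Polygamma_sums C_lim) auto
    show "(\<lambda>k. real n * (fact n / (x + real k + 1) ^ Suc n)) sums
        (real n * ((-1) ^ Suc n * Polygamma n (1 + x)))"
      by (intro sums_mult neg_one_power_mult_Polygamma_sums assms)
  qed
  then show ?thesis by (simp add: C_def)
qed

text \<open>The derivative is \<open>u ^ (n - 1)\<close> times the difference of the two sides of
  \<open>mult_Polygamma_Suc_le\<close>. The shift by 1 keeps the argument away from the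
  poles.\<close>

lemma power_mult_Polygamma_mono:
  fixes x y :: real
  assumes "0 \<le> x" "x \<le> y" "0 < n"
  shows "x ^ n * ((-1) ^ Suc n * Polygamma n (1 + x)) \<le> y ^ n * ((-1) ^ Suc n * Polygamma n (1 + y))"
proof (rule DERIV_nonneg_imp_nondecreasing[OF assms(2)])
  fix u :: real
  assume "x \<le> u" "u \<le> y"
  with assms have u: "0 \<le> u" by simp
  obtain p where n: "n = Suc p" using assms(3) by (cases n) auto
  have nonpos: "1 + u \<notin> \<int>\<^sub>\<le>\<^sub>0" using u by (auto elim!: nonpos_Ints_cases)
  have "((\<lambda>u. u ^ n * ((-1) ^ Suc n * Polygamma n (1 + u))) has_real_derivative
      real n * u ^ (n - 1) * ((-1) ^ Suc n * Polygamma n (1 + u))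
      + u ^ n * ((-1) ^ Suc n * Polygamma (Suc n) (1 + u))) (at u)"
    using nonpos by (auto intro!: derivative_eq_intros)
  \<comment> \<open>Differentiation raises the order of \<open>Polygamma\<close> but keeps the sign
    factor \<open>(-1) ^ Suc n\<close>; rewriting it for order \<open>Suc n\<close> turns the sum
    into a difference.\<close>
  moreover have "real n * u ^ (n - 1) * ((-1) ^ Suc n * Polygamma n (1 + u))
      + u ^ n * ((-1) ^ Suc n * Polygamma (Suc n) (1 + u))
      = u ^ p * (real n * ((-1) ^ Suc n * Polygamma n (1 + u))
                 - u * ((-1) ^ Suc (Suc n) * Polygamma (Suc n) (1 + u)))"
    unfolding n by (simp add: algebra_simps)
  moreover have "0 \<le> \<dots>"
    using mult_Polygamma_Suc_le[OF u assms(3)] u by (intro mult_nonneg_nonneg) auto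
  ultimately show "\<exists>d. ((\<lambda>u. u ^ n * ((-1) ^ Suc n * Polygamma n (1 + u))) has_real_derivative d) (at u)
      \<and> 0 \<le> d"
    by auto
qed

text \<open>Each \<open>x j\<close> is at most the total \<open>S\<close>, so
  \<open>g (x j) \<le> x j * (g S / S)\<close>; these bounds add up to \<open>g S\<close>.\<close>

lemma superadditive_of_quotient_mono:
  fixes g :: "real \<Rightarrow> real"
  assumes "finite J" "\<And>j. j \<in> J \<Longrightarrow> 0 < x j"
    and mono: "\<And>u v. 0 < u \<Longrightarrow> u \<le> v \<Longrightarrow> g u / u \<le> g v / v"
    and "J \<noteq> {}"
  shows "(\<Sum>j\<in>J. g (x j)) \<le> g (\<Sum>j\<in>J. x j)"
proof -
  let ?S = "\<Sum>j\<in>J. x j"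
  have S: "0 < ?S" using assms by (intro sum_pos) auto
  have "(\<Sum>j\<in>J. g (x j)) \<le> (\<Sum>j\<in>J. x j * (g ?S / ?S))"
  proof (rule sum_mono)
    fix j assume j: "j \<in> J"
    then have "x j \<le> ?S"
      using assms by (intro member_le_sum) (auto intro: less_imp_le)
    from mono[OF assms(2)[OF j] this] show "g (x j) \<le> x j * (g ?S / ?S)"
      using assms(2)[OF j] by (simp add: field_simps)
  qed
  also have "\<dots> = g ?S"
    unfolding sum_distrib_right[symmetric] using S by simp
  finally show ?thesis .
qed

text \<open>For positive \<open>x\<close> and \<open>t\<close> this is the \<open>k\<close>-th
  derivative in \<open>t\<close> of \<open>x powr (\<theta> + 2) * \<psi>'(1 + x * t)\<close>: each
  differentiation contributes a factor \<open>x\<close>, and the order is \<open>Suc k\<close>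
  because \<open>\<psi>'\<close> is \<open>Polygamma 1\<close>. The variable \<open>x\<close> comes
  last because superadditivity is in \<open>x\<close>.\<close>

definition weighted_Polygamma :: "real \<Rightarrow> nat \<Rightarrow> real \<Rightarrow> real \<Rightarrow> real" where
  "weighted_Polygamma \<theta> k t x = x powr (\<theta> + 2) * x ^ k * Polygamma (Suc k) (1 + x * t)"

lemma has_derivative_weighted_Polygamma:
  assumes "0 < x" "0 < t"
  shows "((\<lambda>t. weighted_Polygamma \<theta> k t x) has_real_derivative weighted_Polygamma \<theta> (Suc k) t x)
           (at t within A)"
proof -
  have "0 < 1 + x * t" using assms by (simp add: add_pos_pos)
  then have "1 + x * t \<notin> \<int>\<^sub>\<le>\<^sub>0" by (auto elim!: nonpos_Ints_cases)
  then show ?thesis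
    unfolding weighted_Polygamma_def by (auto intro!: derivative_eq_intros simp: algebra_simps)
qed

lemma weighted_Polygamma_0:
  assumes "0 < x" "0 < t"
  shows "weighted_Polygamma \<theta> 0 t x = x powr (\<theta> + 2) * deriv Digamma (1 + x * t)"
proof -
  have "0 < 1 + x * t" using assms by (simp add: add_pos_pos)
  then have "1 + x * t \<notin> \<int>\<^sub>\<le>\<^sub>0" by (auto elim!: nonpos_Ints_cases)
  then show ?thesis
    by (simp add: weighted_Polygamma_def deriv_Polygamma)
qed

lemma weighted_Polygamma_nonneg:
  assumes "0 < x" "0 < t"
  shows "0 \<le> (-1) ^ k * weighted_Polygamma \<theta> k t x"
proof -
  have "0 \<le> x powr (\<theta> + 2) * x ^ k * ((-1) ^ Suc (Suc k) * Polygamma (Suc k) (1 + x * t))"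
    using assms by (intro mult_nonneg_nonneg neg_one_power_mult_Polygamma_nonneg) auto
  then show ?thesis by (simp add: weighted_Polygamma_def algebra_simps)
qed

lemma weighted_Polygamma_quotient_mono:
  assumes "0 < x" "x \<le> y" "0 < t" "0 \<le> \<theta>"
  shows "(-1) ^ k * weighted_Polygamma \<theta> k t x / x \<le> (-1) ^ k * weighted_Polygamma \<theta> k t y / y"
proof -
  define H where "H u = u ^ Suc k * ((-1) ^ Suc (Suc k) * Polygamma (Suc k) (1 + u))" for u :: real
  \<comment> \<open>The powers of \<open>z\<close> combine to
    \<open>z powr \<theta> * z ^ Suc k\<close>, and
    \<open>z ^ Suc k = (z * t) ^ Suc k / t ^ Suc k\<close>. Both remaining factors in
    \<open>z\<close> are nonnegative and nondecreasing, the first because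
    \<open>0 \<le> \<theta>\<close>.\<close>
  have eq: "(-1) ^ k * weighted_Polygamma \<theta> k t z / z = z powr \<theta> * H (z * t) / t ^ Suc k"
    if "0 < z" for z
    using that assms(3)
    by (simp add: weighted_Polygamma_def H_def powr_add power2_eq_square power_mult_distrib)
  have "x powr \<theta> * H (x * t) \<le> y powr \<theta> * H (y * t)"
  proof (rule mult_mono)
    show "H (x * t) \<le> H (y * t)"
      unfolding H_def using assms by (intro power_mult_Polygamma_mono) auto
    show "0 \<le> H (x * t)"
      unfolding H_def using assms
      by (intro mult_nonneg_nonneg[OF _ neg_one_power_mult_Polygamma_nonneg]) auto
  qed (use assms in \<open>auto intro: powr_mono2\<close>)
  then show ?thesis
    using assms by (simp add: eq divide_right_mono del: power_Suc)
qed

lemma weighted_Polygamma_superadditive: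
  assumes "finite J" "J \<noteq> {}" "\<And>j. j \<in> J \<Longrightarrow> 0 < x j" "0 < t" "0 \<le> \<theta>"
  shows "(\<Sum>j\<in>J. (-1) ^ k * weighted_Polygamma \<theta> k t (x j))
           \<le> (-1) ^ k * weighted_Polygamma \<theta> k t (\<Sum>j\<in>J. x j)"
  using assms
  by (intro superadditive_of_quotient_mono weighted_Polygamma_quotient_mono) auto

theorem theorem5p1:
  fixes m n :: nat
    and l :: "nat \<Rightarrow> nat \<Rightarrow> real"
    and \<nu> \<tau> :: "nat \<Rightarrow> real"
    and \<rho> \<theta> :: real
  assumes "1 \<le> m" and "1 \<le> n"
    and "\<And>i j. i \<in> {1..m} \<Longrightarrow> j \<in> {1..n} \<Longrightarrow> 0 < l i j"
    and "\<And>i. i \<in> {1..m} \<Longrightarrow> \<nu> i = (\<Sum>j=1..n. l i j)"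
    and "\<And>j. j \<in> {1..n} \<Longrightarrow> \<tau> j = (\<Sum>i=1..m. l i j)"
    and "\<rho> \<le> 2" and "0 \<le> \<theta>"
  shows "completely_monotonic_on {0<..}
    (\<lambda>t. (\<Sum>i=1..m. \<nu> i powr (\<theta> + 2) * deriv Digamma (1 + \<nu> i * t))
       + (\<Sum>j=1..n. \<tau> j powr (\<theta> + 2) * deriv Digamma (1 + \<tau> j * t))
       - \<rho> * (\<Sum>i=1..m. \<Sum>j=1..n. l i j powr (\<theta> + 2) * deriv Digamma (1 + l i j * t)))"
proof -
  note l_pos = assms(3)
  have \<nu>_pos: "0 < \<nu> i" if "i \<in> {1..m}" for i
    unfolding assms(4)[OF that] using assms(2) l_pos[OF that] by (intro sum_pos) auto
  have \<tau>_pos: "0 < \<tau> j" if "j \<in> {1..n}" for j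
    unfolding assms(5)[OF that] using assms(1) l_pos[OF _ that] by (intro sum_pos) auto
  define D where "D k t =
      (\<Sum>i=1..m. weighted_Polygamma \<theta> k t (\<nu> i)) + (\<Sum>j=1..n. weighted_Polygamma \<theta> k t (\<tau> j))
      - \<rho> * (\<Sum>i=1..m. \<Sum>j=1..n. weighted_Polygamma \<theta> k t (l i j))" for k t
  have "D 0 t = (\<Sum>i=1..m. \<nu> i powr (\<theta> + 2) * deriv Digamma (1 + \<nu> i * t))
       + (\<Sum>j=1..n. \<tau> j powr (\<theta> + 2) * deriv Digamma (1 + \<tau> j * t))
       - \<rho> * (\<Sum>i=1..m. \<Sum>j=1..n. l i j powr (\<theta> + 2) * deriv Digamma (1 + l i j * t))"
    if "0 < t" for t
    unfolding D_def using that by (simp add: weighted_Polygamma_0 \<nu>_pos \<tau>_pos l_pos)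
  moreover have "(D k has_real_derivative D (Suc k) t) (at t within {0<..})" if "0 < t" for k t
    unfolding D_def using that
    by (intro DERIV_diff DERIV_add DERIV_cmult DERIV_sum has_derivative_weighted_Polygamma
        \<nu>_pos \<tau>_pos l_pos)
  moreover have "0 \<le> (-1) ^ k * D k t" if t: "0 < t" for k t
  proof -
    define G where "G x = (-1) ^ k * weighted_Polygamma \<theta> k t x" for x
    let ?L = "\<Sum>i=1..m. \<Sum>j=1..n. G (l i j)"
    have rows: "?L \<le> (\<Sum>i=1..m. G (\<nu> i))"
    proof (rule sum_mono)
      fix i assume i: "i \<in> {1..m}"
      show "(\<Sum>j=1..n. G (l i j)) \<le> G (\<nu> i)"
        unfolding G_def assms(4)[OF i] using assms(2,7) t l_pos[OF i]
        by (intro weighted_Polygamma_superadditive) auto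
    qed
    \<comment> \<open>Exchanging the summations makes the inner sums run over columns, whose totals
      are the \<open>\<tau> j\<close>.\<close>
    have "?L = (\<Sum>j=1..n. \<Sum>i=1..m. G (l i j))"
      by (rule sum.swap)
    also have "\<dots> \<le> (\<Sum>j=1..n. G (\<tau> j))"
    proof (rule sum_mono)
      fix j assume j: "j \<in> {1..n}"
      show "(\<Sum>i=1..m. G (l i j)) \<le> G (\<tau> j)"
        unfolding G_def assms(5)[OF j] using assms(1,7) t l_pos[OF _ j]
        by (intro weighted_Polygamma_superadditive) auto
    qed
    finally have columns: "?L \<le> (\<Sum>j=1..n. G (\<tau> j))" .
    \<comment> \<open>Nonnegativity allows \<open>\<rho>\<close>, of either sign, to be replaced by
      2; one copy of \<open>?L\<close> is then absorbed by the rows and one by the columns.\<close>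
    have "0 \<le> ?L"
      unfolding G_def using t by (intro sum_nonneg weighted_Polygamma_nonneg l_pos)
    then have "\<rho> * ?L \<le> 2 * ?L"
      using assms(6) by (rule mult_right_mono[rotated])
    moreover have "(-1) ^ k * D k t = (\<Sum>i=1..m. G (\<nu> i)) + (\<Sum>j=1..n. G (\<tau> j)) - \<rho> * ?L"
      by (simp add: D_def G_def distrib_left right_diff_distrib sum_distrib_left mult.left_commute)
    ultimately show ?thesis
      using rows columns by linarith
  qed
  ultimately show ?thesis
    unfolding completely_monotonic_on_def
    by (intro conjI exI[of _ D]) (auto simp: is_interval_oi interior_open)
qed

end
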